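(* For $q=3,4,6$ let $\chi_q$ be the primitive character with conductor $q$ given by $\chi_q(1)=1$, $\chi_q(q-1)=-1$, and $\chi_q(a)=0$ for all other $a$ with $1\le a\le q$. Then for $q=3,4,6$ and for all integers $m\geq 0$ we have $H_{2m}(B_{k,\chi_q})=0$ and $$H_{2m+1}(B_{k,\chi_q})=(-1)^{m+1}\left(q^{m-1}(q-2)\right)^{2m+2}\prod_{\ell=1}^m\left(\frac{\ell^4\big((q-2)^2-(q\ell)^2\big)}{4(2\ell+1)(2\ell-1)}\right)^{2(m+1-\ell)}.$$
   Context: For a primitive character $\chi$ with conductor $q$, the generalized Bernoulli numbers $B_{n,\chi}$ belonging to $\chi$ are defined by $\sum_{a=1}^q\frac{\chi(a)te^{at}}{e^{qt}-1}=\sum_{n=0}^\infty B_{n,\chi}\frac{t^n}{n!}$. For a sequence $(c_0,c_1,\ldots)$ (indexed from $k=0$), $H_n(c_k)=\det\big(c_{i+j}\big)_{0\le i,j\le n}$ denotes its $n$th Hankel determinant. *)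

theory Defs
  imports
    "HOL-Number_Theory.Cong"
    "HOL-Computational_Algebra.Formal_Power_Series"
    "Jordan_Normal_Form.Determinant"
begin

definition dirichlet_char :: "nat \<Rightarrow> (nat \<Rightarrow> complex) \<Rightarrow> bool" where
  "dirichlet_char q \<chi> \<longleftrightarrow> q > 0 \<and>
     (\<forall>a b. \<chi> (a * b) = \<chi> a * \<chi> b) \<and>
     (\<forall>a. \<chi> (a + q) = \<chi> a) \<and>
     (\<forall>a. \<chi> a \<noteq> 0 \<longleftrightarrow> coprime a q)"

definition conductor :: "nat \<Rightarrow> (nat \<Rightarrow> complex) \<Rightarrow> nat" where
  "conductor q \<chi> = (LEAST d. d > 0 \<and> d dvd q \<and>
     (\<forall>a. coprime a q \<and> [a = 1] (mod d) \<longrightarrow> \<chi> a = 1))"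

definition primitive_char :: "nat \<Rightarrow> (nat \<Rightarrow> complex) \<Rightarrow> bool" where
  "primitive_char q \<chi> \<longleftrightarrow> dirichlet_char q \<chi> \<and> conductor q \<chi> = q"

(* The generating function is read in the ring of formal power series in t. Its division is
   exact for q > 0: the numerator t * exp (a t) is divisible by t, and exp (q t) - 1 has
   order exactly 1. For a given \<chi>, the parameter q supplies the period in the generating
   function. *)
definition gen_bernoulli_fps :: "nat \<Rightarrow> (nat \<Rightarrow> complex) \<Rightarrow> complex fps" where
  "gen_bernoulli_fps q \<chi> =
     (\<Sum>a = 1..q. (fps_const (\<chi> a) * fps_X * fps_exp (of_nat a)) / (fps_exp (of_nat q) - 1))"

definition gen_bernoulli :: "nat \<Rightarrow> (nat \<Rightarrow> complex) \<Rightarrow> nat \<Rightarrow> complex" where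
  "gen_bernoulli q \<chi> n = fact n * fps_nth (gen_bernoulli_fps q \<chi>) n"

(* The nth Hankel determinant has size n + 1, with indices 0, ..., n. *)
definition hankel_det :: "nat \<Rightarrow> (nat \<Rightarrow> complex) \<Rightarrow> complex" where
  "hankel_det n c = det (mat (n + 1) (n + 1) (\<lambda>(i, j). c (i + j)))"

(* The q-periodic function with the prescribed values on {1..q}; used for q = 3, 4, 6.
   For q = 3, 4 it is a primitive character modulo q. For q = 6 it is a Dirichlet character
   modulo 6, but of conductor 3 (there is no primitive character of conductor 6), so there
   "primitive with conductor 6" is to be read as "character modulo 6", and the generating
   function uses the modulus 6. *)
definition chi :: "nat \<Rightarrow> nat \<Rightarrow> complex" where
  "chi q a = (if a mod q = 1 then 1 else if a mod q = q - 1 then -1 else 0)"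

lemma gen_bernoulli_fps_eq:
  assumes "q > 0"
  shows "gen_bernoulli_fps q \<chi> * (fps_exp (of_nat q) - 1) =
           (\<Sum>a = 1..q. fps_const (\<chi> a) * fps_X * fps_exp (of_nat a))"
proof -
  let ?g = "fps_exp (of_nat q) - 1 :: complex fps"
  have g1: "fps_nth ?g 1 \<noteq> 0"
    using assms by simp
  have "fps_nth ?g 0 = 0"
    by simp
  with g1 have sub: "subdegree ?g = 1"
    by (intro subdegreeI) auto
  have nz: "?g \<noteq> 0"
    using g1 by (metis fps_zero_nth)
  have "(fps_const (\<chi> a) * fps_X * fps_exp (of_nat a)) / ?g * ?g =
          fps_const (\<chi> a) * fps_X * fps_exp (of_nat a)" for a
  proof -
    have "?g dvd fps_X"
      using nz sub by (subst fps_dvd_iff) auto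
    then have "?g dvd fps_const (\<chi> a) * fps_X * fps_exp (of_nat a)"
      by (intro dvd_mult2 dvd_mult)
    then show ?thesis
      by (rule dvd_div_mult_self)
  qed
  then show ?thesis
    by (simp add: gen_bernoulli_fps_def sum_distrib_right)
qed

lemma chi_values:
  assumes "q \<in> {3, 4, 6}"
  shows "chi q 1 = 1" "chi q (q - 1) = -1"
    "\<And>a. 1 \<le> a \<Longrightarrow> a \<le> q \<Longrightarrow> a \<noteq> 1 \<Longrightarrow> a \<noteq> q - 1 \<Longrightarrow> chi q a = 0"
proof -
  show "chi q 1 = 1" "chi q (q - 1) = -1"
    using assms by (auto simp: chi_def)
  fix a assume "1 \<le> a" "a \<le> q" "a \<noteq> 1" "a \<noteq> q - 1"
  then show "chi q a = 0"
    using assms by (cases "a = q") (auto simp: chi_def)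
qed

lemma coprime_iff_mod:
  fixes a q :: nat
  assumes "q \<in> {3, 4, 6}"
  shows "coprime a q \<longleftrightarrow> a mod q = 1 \<or> a mod q = q - 1"
proof -
  define r where "r = a mod q"
  have red: "coprime a q \<longleftrightarrow> coprime r q"
    unfolding r_def by (metis coprime_mod_left_iff assms insertE singletonD zero_neq_numeral)
  consider "q = 3" | "q = 4" | "q = 6"
    using assms by auto
  then have "coprime r q \<longleftrightarrow> r = 1 \<or> r = q - 1"
  proof cases
    case 1
    then have "r < 3"
      by (simp add: r_def)
    then have "r = 0 \<or> r = 1 \<or> r = 2"
      by linarith
    moreover have "\<not> coprime (0 :: nat) 3" "coprime (1 :: nat) 3" "coprime (2 :: nat) 3"
      by code_simp+
    ultimately show ?thesis
      using 1 by (elim disjE) simp_all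
  next
    case 2
    then have "r < 4"
      by (simp add: r_def)
    then have "r = 0 \<or> r = 1 \<or> r = 2 \<or> r = 3"
      by linarith
    moreover have "\<not> coprime (0 :: nat) 4" "coprime (1 :: nat) 4" "\<not> coprime (2 :: nat) 4"
        "coprime (3 :: nat) 4"
      by code_simp+
    ultimately show ?thesis
      using 2 by (elim disjE) simp_all
  next
    case 3
    then have "r < 6"
      by (simp add: r_def)
    then have "r = 0 \<or> r = 1 \<or> r = 2 \<or> r = 3 \<or> r = 4 \<or> r = 5"
      by linarith
    moreover have "\<not> coprime (0 :: nat) 6" "coprime (1 :: nat) 6" "\<not> coprime (2 :: nat) 6"
        "\<not> coprime (3 :: nat) 6" "\<not> coprime (4 :: nat) 6" "coprime (5 :: nat) 6"
      by code_simp+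
    ultimately show ?thesis
      using 3 by (elim disjE) simp_all
  qed
  with red show ?thesis
    by (simp add: r_def)
qed

lemma chi_dirichlet_char:
  assumes q: "q \<in> {3, 4, 6}"
  shows "dirichlet_char q (chi q)"
  unfolding dirichlet_char_def
proof (intro conjI allI)
  show "q > 0"
    using q by auto
  show "chi q (a + q) = chi q a" for a
    by (simp add: chi_def)
  show "chi q a \<noteq> 0 \<longleftrightarrow> coprime a q" for a
    using coprime_iff_mod[OF q, of a] by (auto simp: chi_def)
  fix a b
  show "chi q (a * b) = chi q a * chi q b"
  proof (cases "coprime a q \<and> coprime b q")
    case True
    have "(a * b) mod q = ((a mod q) * (b mod q)) mod q"
      by (simp add: mod_mult_eq)
    with True coprime_iff_mod[OF q, of a] coprime_iff_mod[OF q, of b] q show ?thesis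
      by (auto simp: chi_def)
  next
    case False
    then have "\<not> coprime (a * b) q"
      by simp
    with False coprime_iff_mod[OF q, of a] coprime_iff_mod[OF q, of b]
      coprime_iff_mod[OF q, of "a * b"] show ?thesis
      by (auto simp: chi_def)
  qed
qed

lemma chi_primitive:
  assumes "q \<in> {3, 4}"
  shows "primitive_char q (chi q)"
proof -
  let ?P = "\<lambda>d. d > 0 \<and> d dvd q \<and> (\<forall>a. coprime a q \<and> [a = 1] (mod d) \<longrightarrow> chi q a = 1)"
  have q: "q \<in> {3, 4, 6}"
    using assms by auto
  have cop: "coprime (q - 1) q"
    using coprime_iff_mod[OF q, of "q - 1"] q by auto
  have "(LEAST d. ?P d) = q"
  proof (rule Least_equality)
    show "?P q"
      using assms by (auto simp: chi_def cong_def)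
    fix d assume d: "?P d"
    show "q \<le> d"
    proof (rule ccontr)
      assume "\<not> q \<le> d"
      then have "d \<in> {0, 1, 2, 3}"
        using assms by auto
      with d assms \<open>\<not> q \<le> d\<close> have "[q - 1 = 1] (mod d)"
        by (auto simp: cong_def)
      with d cop have "chi q (q - 1) = 1"
        by blast
      with chi_values(2)[OF q] show False
        by simp
    qed
  qed
  with chi_dirichlet_char[OF q] show ?thesis
    by (simp add: primitive_char_def conductor_def)
qed

lemma conductor_chi_6: "conductor 6 (chi 6) = 3"
  unfolding conductor_def
proof (rule Least_equality)
  let ?P = "\<lambda>d :: nat. d > 0 \<and> d dvd 6 \<and> (\<forall>a. coprime a 6 \<and> [a = 1] (mod d) \<longrightarrow> chi 6 a = 1)"
  show "?P 3"
  proof (intro conjI allI impI)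
    fix a :: nat assume a: "coprime a 6 \<and> [a = 1] (mod 3)"
    have "a mod 6 = 1 \<or> a mod 6 = 5"
      using a coprime_iff_mod[of 6 a] by simp
    moreover have "a mod 3 = 1"
      using a by (simp add: cong_def)
    ultimately have "a mod 6 = 1"
      by presburger
    then show "chi 6 a = 1"
      by (simp add: chi_def)
  qed auto
  fix d assume d: "?P d"
  show "3 \<le> d"
  proof (rule ccontr)
    assume "\<not> 3 \<le> d"
    with d have "d = 1 \<or> d = 2"
      by auto
    then have "[5 = 1] (mod d)"
      by (auto simp: cong_def)
    moreover have "coprime 5 (6 :: nat)"
      using coprime_iff_mod[of 6 5] by simp
    ultimately have "chi 6 5 = 1"
      using d by blast
    then show False
      by (simp add: chi_def)
  qed
qed

end

theory Submission
  imports Defs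
begin

text \<open>Write \<open>B\<^sub>n\<close> for the numbers belonging to \<open>\<chi>\<^sub>q\<close> and \<open>S\<close> for the linear functional
  \<open>S(y\<^sup>n) = B\<^sub>n\<close> on polynomials. The generating function says
  \<open>S(p(y + q) - p(y)) = p'(1) - p'(q - 1)\<close>, and it is odd, so \<open>B\<^sub>n = 0\<close> for even \<open>n\<close>. Separating
  even and odd indices turns the Hankel matrix into an antidiagonal block matrix; this settles the
  even case and reduces the odd one to the square of the determinant of \<open>(B\<^bsub>2(i+j)+1\<^esub>)\<close>.

  The orthogonal polynomials behind these moments are Wilson polynomials, but they are not needed:
  in the two monic bases \<open>\<Phi>\<^sub>k = \<Prod>\<^bsub>i<k\<^esub> (z - (q(i+1) - 1)\<^sup>2)\<close> and
  \<open>\<Psi>\<^sub>j = \<Prod>\<^bsub>i<j\<^esub> (z - (qi + 1)\<^sup>2)\<close>, with \<open>z = y\<^sup>2\<close>, the moments \<open>S(y \<Phi>\<^sub>k \<Psi>\<^sub>j)\<close> have the form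
  \<open>u\<^sub>k v\<^sub>j / (k + j + 1)\<close>, so that only a Hilbert determinant remains.\<close>

section \<open>Determinants\<close>

lemma det_mat_sum:
  fixes a b :: "nat \<Rightarrow> nat \<Rightarrow> 'a :: comm_ring_1"
  shows "det (mat n n (\<lambda>(i, j). \<Sum>l<n. a i l * b l j)) =
           det (mat n n (\<lambda>(i, j). a i j)) * det (mat n n (\<lambda>(i, j). b i j))"
proof -
  have "mat n n (\<lambda>(i, j). \<Sum>l<n. a i l * b l j) =
          mat n n (\<lambda>(i, j). a i j) * mat n n (\<lambda>(i, j). b i j)"
    by (rule eq_matI) (auto simp: scalar_prod_def atLeast0LessThan)
  then show ?thesis
    by (simp add: det_mult[of _ n])
qed

lemma det_mat_lower_triangular:
  fixes a :: "nat \<Rightarrow> nat \<Rightarrow> 'a :: comm_ring_1"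
  assumes "\<And>i j. i < j \<Longrightarrow> j < n \<Longrightarrow> a i j = 0"
  shows "det (mat n n (\<lambda>(i, j). a i j)) = (\<Prod>i<n. a i i)"
  using assms
  by (subst det_lower_triangular[of n])
     (auto simp: prod_list_diag_prod atLeast0LessThan intro!: prod.cong)

lemma det_mat_transpose:
  fixes a :: "nat \<Rightarrow> nat \<Rightarrow> 'a :: comm_ring_1"
  shows "det (mat n n (\<lambda>(i, j). a j i)) = det (mat n n (\<lambda>(i, j). a i j))"
proof -
  have "mat n n (\<lambda>(i, j). a j i) = transpose_mat (mat n n (\<lambda>(i, j). a i j))"
    by (rule eq_matI) auto
  then show ?thesis
    by (simp add: det_transpose[of _ n])
qed

text \<open>Rows and columns are permuted alike, so the sign of \<open>p\<close> enters twice and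
  squares to 1; the columns are reached by transposing.\<close>

lemma det_mat_reindex:
  fixes a :: "nat \<Rightarrow> nat \<Rightarrow> 'a :: comm_ring_1"
  assumes "p permutes {0..<n}"
  shows "det (mat n n (\<lambda>(i, j). a (p i) (p j))) = det (mat n n (\<lambda>(i, j). a i j))"
proof -
  have p: "i < n \<Longrightarrow> p i < n" for i
    using permutes_in_image[OF assms, of i] by simp
  have rows: "det (mat n n (\<lambda>(i, j). c (p i) j)) = signof p * det (mat n n (\<lambda>(i, j). c i j))"
    for c :: "nat \<Rightarrow> nat \<Rightarrow> 'a"
  proof -
    have "mat n n (\<lambda>(i, j). c (p i) j) =
       mat n n (\<lambda>(i, j). mat n n (\<lambda>(i, j). c i j) $$ (p i, j))"
      by (rule eq_matI) (auto simp: p)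
    then show ?thesis
      using det_permute_rows[OF _ assms, of "mat n n (\<lambda>(i, j). c i j)"] by simp
  qed
  have "det (mat n n (\<lambda>(i, j). a (p i) (p j))) = signof p * det (mat n n (\<lambda>(i, j). a i (p j)))"
    by (rule rows)
  also have "det (mat n n (\<lambda>(i, j). a i (p j))) = det (mat n n (\<lambda>(i, j). a j (p i)))"
    by (rule det_mat_transpose[symmetric])
  also have "\<dots> = signof p * det (mat n n (\<lambda>(i, j). a j i))"
    by (rule rows)
  also have "det (mat n n (\<lambda>(i, j). a j i)) = det (mat n n (\<lambda>(i, j). a i j))"
    by (rule det_mat_transpose)
  finally show ?thesis
    by (simp add: sign_def)
qed

text \<open>Conjugation by the diagonal matrix of signs \<open>(-1) ^ i\<close> negates every entry
  with \<open>i + j\<close> odd, and the other entries vanish. The size \<open>2 * m + 1\<close> is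
  odd, so the determinant equals its own negative.\<close>

lemma hankel_det_even_eq_0:
  assumes "\<And>k. even k \<Longrightarrow> c k = 0"
  shows "hankel_det (2 * m) c = 0"
proof -
  let ?n = "2 * m + 1"
  define s :: "nat \<Rightarrow> nat \<Rightarrow> complex" where "s i j = (if i = j then (-1) ^ i else 0)" for i j
  have s: "det (mat ?n ?n (\<lambda>(i, j). s i j)) = (\<Prod>i<?n. (-1) ^ i)"
    by (subst det_mat_lower_triangular) (auto simp: s_def)
  have "c (i + j) = - ((-1) ^ i * (-1) ^ j * c (i + j))" for i j
  proof (cases "even (i + j)")
    case True
    then show ?thesis by (simp add: assms)
  next
    case False
    then show ?thesis by (simp flip: power_add)
  qed
  note sign = this
  have s_sum: "(\<Sum>l<?n. s i l * f l) = (-1) ^ i * f i"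
    "(\<Sum>l<?n. f l * s l i) = (-1) ^ i * f i" if "i < ?n" for i f
    using that
    by (simp_all add: s_def if_distrib[of "\<lambda>x. _ * x"] if_distrib[of "\<lambda>x. x * _"] mult.commute
        del: sum.lessThan_Suc cong: if_cong)
  have "(\<Sum>l<?n. s i l * (\<Sum>k<?n. c (l + k) * s k j)) = - c (i + j)" if "i < ?n" "j < ?n" for i j
    unfolding s_sum(1)[OF that(1)] s_sum(2)[OF that(2)]
    by (metis sign mult.assoc minus_minus)
  then have "mat ?n ?n (\<lambda>(i, j). c (i + j)) =
     (-1) \<cdot>\<^sub>m mat ?n ?n (\<lambda>(i, j). \<Sum>l<?n. s i l * (\<Sum>k<?n. c (l + k) * s k j))"
    by (intro eq_matI) (simp_all del: sum.lessThan_Suc)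
  then have "det (mat ?n ?n (\<lambda>(i, j). c (i + j))) =
      det ((-1) \<cdot>\<^sub>m mat ?n ?n (\<lambda>(i, j). \<Sum>l<?n. s i l * (\<Sum>k<?n. c (l + k) * s k j)))"
    by (rule arg_cong)
  also have "\<dots> = (-1) ^ ?n * (det (mat ?n ?n (\<lambda>(i, j). s i j)) *
       (det (mat ?n ?n (\<lambda>(i, j). c (i + j))) * det (mat ?n ?n (\<lambda>(i, j). s i j))))"
    by (simp only: det_smult det_mat_sum dim_col_mat)
  also have "\<dots> = (-1) ^ ?n * det (mat ?n ?n (\<lambda>(i, j). c (i + j))) *
      (\<Prod>i<?n. (-1) ^ i * (-1) ^ i)"
    unfolding s prod.distrib by (simp only: ac_simps)
  also have "(\<Prod>i<?n. (-1) ^ i * (-1) ^ i) = (1 :: complex)"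
    by (simp flip: power_mult_distrib del: prod.lessThan_Suc)
  finally show ?thesis
    by (simp add: hankel_det_def)
qed

lemma hankel_det_odd_eq:
  assumes c: "\<And>k. even k \<Longrightarrow> c k = 0"
  shows "hankel_det (2 * m + 1) c = (-1) ^ (m + 1) * hankel_det m (\<lambda>k. c (2 * k + 1)) ^ 2"
proof -
  let ?n = "m + 1"
  \<comment> \<open>\<open>p\<close> lists the even indices below \<open>2 * ?n\<close> first and
    then the odd ones; being the identity beyond them makes it a permutation in the sense of
    \<open>permutes\<close>.\<close>
  define p where "p i = (if i < ?n then 2 * i else if i < 2 * ?n then 2 * (i - ?n) + 1 else i)" for i
  have "bij_betw p {0..<2 * ?n} {0..<2 * ?n}"
    by (rule bij_betw_byWitness[where f' = "\<lambda>i. if even i then i div 2 else ?n + i div 2"])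
       (auto simp: p_def elim!: evenE oddE)
  then have p: "p permutes {0..<2 * ?n}"
    by (rule bij_imp_permutes) (auto simp: p_def)
  let ?D = "mat ?n ?n (\<lambda>(i, j). c (2 * (i + j) + 1))"
  have "hankel_det (2 * m + 1) c = det (mat (2 * ?n) (2 * ?n) (\<lambda>(i, j). c (i + j)))"
    by (simp add: hankel_det_def)
  also have "\<dots> = det (mat (2 * ?n) (2 * ?n) (\<lambda>(i, j). c (p i + p j)))"
    by (rule det_mat_reindex[OF p, symmetric])
  also have "mat (2 * ?n) (2 * ?n) (\<lambda>(i, j). c (p i + p j)) =
      four_block_mat (0\<^sub>m ?n ?n) ?D ?D (0\<^sub>m ?n ?n)"
    by (rule eq_matI) (auto simp: p_def c intro!: arg_cong[where f = c])
  also have "det \<dots> = det (0\<^sub>m ?n ?n * 0\<^sub>m ?n ?n - ?D * ?D)"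
    by (rule det_four_block_mat) auto
  also have "0\<^sub>m ?n ?n * 0\<^sub>m ?n ?n - ?D * ?D = (-1) \<cdot>\<^sub>m (?D * ?D)"
    by (rule eq_matI) auto
  also have "det \<dots> = (-1) ^ ?n * (det ?D) ^ 2"
    by (simp add: det_mult[of _ ?n] power2_eq_square)
  finally show ?thesis
    by (simp add: hankel_det_def)
qed

section \<open>Moment functionals\<close>

text \<open>The umbral functional \<open>y^n\<close> to \<open>c n\<close>: Hankel entries are its
  values on products of monomials.\<close>

definition moment_functional :: "(nat \<Rightarrow> 'a :: comm_ring_1) \<Rightarrow> 'a poly \<Rightarrow> 'a" where
  "moment_functional c p = (\<Sum>i\<le>degree p. coeff p i * c i)"

lemma moment_functional_eq_sum:
  assumes "degree p \<le> n"
  shows "moment_functional c p = (\<Sum>i\<le>n. coeff p i * c i)"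
  unfolding moment_functional_def using assms
  by (intro sum.mono_neutral_left) (auto simp: coeff_eq_0)

lemma moment_functional_add:
  "moment_functional c (p + q) = moment_functional c p + moment_functional c q"
proof -
  let ?n = "max (degree p) (degree q)"
  have "degree (p + q) \<le> ?n"
    by (rule degree_add_le) auto
  then show ?thesis
    by (simp add: moment_functional_eq_sum[of _ ?n] sum.distrib algebra_simps)
qed

lemma moment_functional_monom [simp]: "moment_functional c (monom a n) = a * c n"
  by (simp add: moment_functional_eq_sum[OF degree_monom_le] if_distrib if_distribR cong: if_cong)

lemma moment_functional_smult: "moment_functional c (smult a p) = a * moment_functional c p"
  unfolding moment_functional_eq_sum[OF degree_smult_le]
  by (simp add: moment_functional_def sum_distrib_left mult.assoc)

lemma moment_functional_0 [simp]: "moment_functional c 0 = 0"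
  by (simp add: moment_functional_def)

lemma moment_functional_diff:
  "moment_functional c (p - q) = moment_functional c p - moment_functional c q"
  using moment_functional_add[of c "p - q" q] by simp

lemma moment_functional_sum:
  "moment_functional c (\<Sum>i\<in>A. f i) = (\<Sum>i\<in>A. moment_functional c (f i))"
  by (induction A rule: infinite_finite_induct) (simp_all add: moment_functional_add)

lemma additive_poly_ext:
  fixes f g :: "'a :: comm_monoid_add poly \<Rightarrow> 'b :: cancel_comm_monoid_add"
  assumes f: "\<And>p q. f (p + q) = f p + f q"
    and g: "\<And>p q. g (p + q) = g p + g q"
    and eq: "\<And>a n. f (monom a n) = g (monom a n)"
  shows "f p = g p"
proof -
  have "f (\<Sum>i\<in>A. monom (coeff p i) i) = g (\<Sum>i\<in>A. monom (coeff p i) i)" for A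
    using eq[of 0 0] by (induction A rule: infinite_finite_induct) (auto simp: f g eq)
  from this[of "{..degree p}"] show ?thesis
    by (simp add: poly_as_sum_of_monoms)
qed

text \<open>Passing from monomials to a monic basis multiplies by a unitriangular coefficient
  matrix. Left and right bases are independent, which permits two families adapted to different
  roots.\<close>

lemma hankel_det_monic_bases:
  assumes deg: "\<And>i. degree (\<phi> i) = i" "\<And>i. degree (\<psi> i) = i"
    and monic: "\<And>i. lead_coeff (\<phi> i) = 1" "\<And>i. lead_coeff (\<psi> i) = 1"
  shows "hankel_det n c =
    det (mat (n + 1) (n + 1) (\<lambda>(i, j). moment_functional c (\<phi> i * \<psi> j)))"
proof -
  let ?N = "n + 1"
  have expand: "moment_functional c (p * q) =
      (\<Sum>a<?N. coeff p a * (\<Sum>b<?N. c (a + b) * coeff q b))"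
    if "degree p \<le> n" "degree q \<le> n" for p q
  proof -
    have "p * q = (\<Sum>a\<le>n. monom (coeff p a) a) * (\<Sum>b\<le>n. monom (coeff q b) b)"
      using that by (simp add: poly_as_sum_of_monoms')
    also have "\<dots> = (\<Sum>a\<le>n. \<Sum>b\<le>n. monom (coeff p a * coeff q b) (a + b))"
      by (simp add: sum_product mult_monom)
    finally show ?thesis
      by (simp add: moment_functional_sum sum_distrib_left lessThan_Suc_atMost mult_ac)
  qed
  have "mat ?N ?N (\<lambda>(i, j). moment_functional c (\<phi> i * \<psi> j)) =
      mat ?N ?N (\<lambda>(i, j). \<Sum>a<?N. coeff (\<phi> i) a * (\<Sum>b<?N. c (a + b) * coeff (\<psi> j) b))"
    by (rule eq_matI) (auto simp: expand deg simp del: sum.lessThan_Suc)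
  then have "det (mat ?N ?N (\<lambda>(i, j). moment_functional c (\<phi> i * \<psi> j))) =
      det (mat ?N ?N (\<lambda>(i, j). coeff (\<phi> i) j)) *
      (hankel_det n c * det (mat ?N ?N (\<lambda>(i, j). coeff (\<psi> j) i)))"
    by (simp only: det_mat_sum hankel_det_def)
  also have "det (mat ?N ?N (\<lambda>(i, j). coeff (\<phi> i) j)) = 1"
    using monic(1) deg(1)
    by (subst det_mat_lower_triangular) (auto simp: coeff_eq_0 simp del: prod.lessThan_Suc)
  also have "det (mat ?N ?N (\<lambda>(i, j). coeff (\<psi> j) i)) = det (mat ?N ?N (\<lambda>(i, j). coeff (\<psi> i) j))"
    by (rule det_mat_transpose)
  also have "\<dots> = 1"
    using monic(2) deg(2)
    by (subst det_mat_lower_triangular) (auto simp: coeff_eq_0 simp del: prod.lessThan_Suc)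
  finally show ?thesis by simp
qed

lemma pcompose_monom: "pcompose (monom a n) p = smult a (p ^ n)"
  for p :: "'a :: comm_ring_1 poly"
  by (induction n) (simp_all add: monom_0 monom_Suc pcompose_pCons pcompose_const)

text \<open>Substituting \<open>z = y^2\<close> after splitting off one factor \<open>y\<close>
  turns the odd moments into ordinary moments in \<open>z\<close>.\<close>

lemma moment_functional_odd_part:
  fixes c :: "nat \<Rightarrow> 'a :: comm_ring_1"
  shows "moment_functional c ([:0, 1:] * pcompose p [:0, 0, 1:]) =
     moment_functional (\<lambda>k. c (2 * k + 1)) p"
proof (rule additive_poly_ext[of "\<lambda>p. moment_functional c ([:0, 1:] * pcompose p [:0, 0, 1:])"])
  fix a :: 'a and n
  have "[:0, 0, 1:] = monom (1 :: 'a) 2"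
    by (simp add: monom_altdef power2_eq_square)
  then have "pcompose (monom a n) [:0, 0, 1:] = monom a (2 * n)"
    by (simp only: pcompose_monom monom_power) (simp add: smult_monom)
  then have "[:0, 1:] * pcompose (monom a n) [:0, 0, 1:] = monom a (2 * n + 1)"
    by (simp add: monom_Suc)
  then show "moment_functional c ([:0, 1:] * pcompose (monom a n) [:0, 0, 1:]) =
      moment_functional (\<lambda>k. c (2 * k + 1)) (monom a n)"
    by (simp only: moment_functional_monom)
qed (simp_all only: pcompose_add moment_functional_add distrib_left)

section \<open>The Hilbert matrix\<close>

text \<open>This is the integral over [0, 1] of \<open>x^i\<close> times the shifted Legendre
  polynomial of degree \<open>n\<close>, whose squared norm is \<open>1 / (2 n + 1)\<close>.\<close>

definition hilbert_factor :: "nat \<Rightarrow> nat \<Rightarrow> 'a :: field_char_0" where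
  "hilbert_factor i n =
    (if n \<le> i then fact i ^ 2 / (fact (i - n) * fact (i + n + 1)) else 0)"

text \<open>Parseval's identity for \<open>x^i\<close> and \<open>x^j\<close> in the shifted
  Legendre basis, proved here by telescoping. It factors the Hilbert matrix as lower triangular
  times diagonal times upper triangular.\<close>

lemma hilbert_matrix_factorization:
  assumes "i < N"
  shows "1 / of_nat (i + j + 1) =
    (\<Sum>n<N. of_nat (2 * n + 1) * hilbert_factor i n * hilbert_factor j n :: 'a :: field_char_0)"
proof -
  let ?a = "hilbert_factor :: nat \<Rightarrow> nat \<Rightarrow> 'a"
  \<comment> \<open>\<open>(i + j + 1)\<close> times the \<open>n\<close>-th summand is \<open>b n - b (n + 1)\<close>, because
    \<open>(2n + 1) (i + j + 1) = (i + n + 1) (j + n + 1) - (i - n) (j - n)\<close>\<close>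
  define b :: "nat \<Rightarrow> 'a" where
    "b n = (if n \<le> i \<and> n \<le> j
      then fact i ^ 2 * fact j ^ 2 / (fact (i - n) * fact (i + n) * fact (j - n) * fact (j + n)) else 0)" for n
  have nz: "(of_nat i + of_nat j + 1 :: 'a) \<noteq> 0" for i j :: nat
    using of_nat_neq_0[of "i + j", where ?'a = 'a] by (simp add: add_ac)
  \<comment> \<open>Here \<open>R\<close>, \<open>S\<close> stand for the factorials of
    \<open>i - n - 1\<close>, \<open>j - n - 1\<close> and \<open>P\<close>, \<open>Q\<close> for
    those of \<open>i + n\<close>, \<open>j + n\<close>; the letters \<open>x\<close>,
    \<open>y\<close>, \<open>X\<close>, \<open>Y\<close> are the factors \<open>i - n\<close>,
    \<open>j - n\<close>, \<open>i + n + 1\<close>, \<open>j + n + 1\<close> split off from the next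
    factorials.\<close>
  have telescope: "c * (d * (I / (x * R * (X * P))) * (J / (y * S * (Y * Q)))) =
      I * J / (x * R * P * (y * S) * Q) - I * J / (R * (X * P) * S * (Y * Q))"
    if "c * d = X * Y - x * y" "x \<noteq> 0" "y \<noteq> 0" "X \<noteq> 0" "Y \<noteq> 0" "R \<noteq> 0" "S \<noteq> 0" "P \<noteq> 0" "Q \<noteq> 0"
    for c d I J x y X Y R S P Q :: 'a
  proof -
    have "c * (d * (I / (x * R * (X * P))) * (J / (y * S * (Y * Q)))) =
        c * d * (I * J / (x * R * X * P * y * S * Y * Q))"
      by (simp add: mult_ac)
    also have "\<dots> = I * J / (x * R * P * (y * S) * Q) - I * J / (R * (X * P) * S * (Y * Q))"
      unfolding that(1) using that(2-) by (simp add: field_simps)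
    finally show ?thesis .
  qed
  have "of_nat (i + j + 1) * (of_nat (2 * n + 1) * ?a i n * ?a j n) = b n - b (Suc n)" for n
  proof -
    \<comment> \<open>At \<open>n = min i j\<close> the term \<open>b (Suc n)\<close> takes its
      default value 0, so the generic factorial computation is left for smaller
      \<open>n\<close>.\<close>
    consider "n > i \<or> n > j" | "n = i" "i \<le> j" | "n = j" "j < i" | "n < i" "n < j"
      by linarith
    then show ?thesis
    proof cases
      case 1
      then show ?thesis by (auto simp: hilbert_factor_def b_def)
    next
      case 2
      then show ?thesis
        using nz[of i j] nz[of i i]
        by (simp add: hilbert_factor_def b_def divide_simps) (simp add: algebra_simps)
    next
      case 3
      then show ?thesis
        using nz[of i j] nz[of j j]
        by (simp add: hilbert_factor_def b_def divide_simps) (simp add: algebra_simps)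
    next
      case 4
      then obtain r s where rs: "i = n + r + 1" "j = n + s + 1"
        by (metis add.assoc less_natE Suc_eq_plus1 add_Suc_right)
      have fact_eqs: "fact (n + x + 1 - n) = of_nat (x + 1) * (fact x :: 'a)"
        "fact (n + x + 1 + n + 1) = of_nat (n + x + 1 + n + 1) * (fact (n + x + 1 + n) :: 'a)"
        "fact (n + x + 1 - Suc n) = (fact x :: 'a)"
        "fact (n + x + 1 + Suc n) = of_nat (n + x + 1 + n + 1) * (fact (n + x + 1 + n) :: 'a)" for x
        by (simp_all add: algebra_simps)
      have cond: "n \<le> n + x + 1" "Suc n \<le> n + x + 1" for x
        by simp_all
      have "of_nat (n + r + 1 + (n + s + 1) + 1) * of_nat (2 * n + 1) =
        of_nat (n + r + 1 + n + 1) * of_nat (n + s + 1 + n + 1) - of_nat (r + 1) * (of_nat (s + 1) :: 'a)"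
        by (simp add: algebra_simps)
      then show ?thesis
        unfolding rs hilbert_factor_def b_def
        by (simp only: cond if_True simp_thms fact_eqs)
           (rule telescope; simp only: of_nat_eq_0_iff fact_nonzero not_False_eq_True; simp)
    qed
  qed
  then have "of_nat (i + j + 1) * (\<Sum>n<N. of_nat (2 * n + 1) * ?a i n * ?a j n) =
      (\<Sum>n<N. b n - b (Suc n))"
    by (simp only: sum_distrib_left)
  also have "\<dots> = b 0 - b N"
    by (rule sum_lessThan_telescope')
  \<comment> \<open>\<open>b N\<close> is the default 0 because \<open>i < N\<close>, and in
    \<open>b 0\<close> all factorials cancel.\<close>
  also have "\<dots> = 1"
    using assms by (simp add: b_def power2_eq_square)
  finally show ?thesis
    using nz[of i j] by (simp add: field_simps)
qed

section \<open>The numbers belonging to the characters\<close>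

context
  fixes q :: nat
  assumes q: "3 \<le> q"
begin

section \<open>Generating function, parity and the shift relation\<close>

private abbreviation (input) "B \<equiv> gen_bernoulli q (chi q)"
private abbreviation (input) "F \<equiv> gen_bernoulli_fps q (chi q)"

text \<open>Only the residues 1 and \<open>q - 1\<close> contribute, and \<open>3 \<le> q\<close>
  keeps them distinct.\<close>

lemma gen_bernoulli_fps_chi:
  "F * (fps_exp (of_nat q) - 1) = fps_X * (fps_exp 1 - fps_exp (of_nat q - 1))"
proof -
  have "(\<Sum>a = 1..q. fps_const (chi q a) * fps_X * fps_exp (of_nat a)) =
      (\<Sum>a \<in> {1, q - 1}. fps_const (chi q a) * fps_X * fps_exp (of_nat a))"
    using q by (intro sum.mono_neutral_right)
      (auto simp: chi_def le_less intro!: fps_ext)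
  also have "\<dots> = fps_X * (fps_exp 1 - fps_exp (of_nat q - 1))"
  proof -
    have "chi q 1 = 1" "chi q (q - 1) = - 1" "1 \<noteq> q - 1"
      using q by (auto simp: chi_def)
    moreover have "(of_nat (q - 1) :: complex) = of_nat q - 1"
      using q by (simp add: of_nat_diff)
    ultimately show ?thesis
      by (simp add: algebra_simps flip: fps_const_neg)
  qed
  finally show ?thesis
    using gen_bernoulli_fps_eq[of q "chi q"] q by simp
qed

text \<open>Replacing \<open>t\<close> by \<open>-t\<close> and multiplying by
  \<open>exp (q t)\<close> interchanges the two exponentials on the right, so \<open>F\<close> is an
  odd series.\<close>

lemma gen_bernoulli_chi_even:
  assumes "even k"
  shows "B k = 0"
proof -
  let ?E = "fps_exp :: complex \<Rightarrow> complex fps"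
  let ?r = "\<lambda>f :: complex fps. fps_compose f (- fps_X)"
  have "?r (F * (?E (of_nat q) - 1)) = ?r (fps_X * (?E 1 - ?E (of_nat q - 1)))"
    by (simp only: gen_bernoulli_fps_chi)
  then have "?r F * (?E (- of_nat q) - 1) = - fps_X * (?E (- 1) - ?E (- (of_nat q - 1)))"
    by (simp add: fps_compose_mult_distrib fps_compose_sub_distrib)
  then have "?r F * (?E (- of_nat q) - 1) * ?E (of_nat q) =
      - fps_X * (?E (- 1) - ?E (- (of_nat q - 1))) * ?E (of_nat q)"
    by simp
  then have "?r F * (?E (- of_nat q + of_nat q) - ?E (of_nat q)) =
      - fps_X * (?E (- 1 + of_nat q) - ?E (- (of_nat q - 1) + of_nat q))"
    by (simp only: fps_exp_add_mult) (simp add: algebra_simps)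
  then have "- ?r F * (?E (of_nat q) - 1) = fps_X * (?E 1 - ?E (of_nat q - 1))"
    by (simp add: algebra_simps)
  also have "\<dots> = F * (?E (of_nat q) - 1)"
    by (rule gen_bernoulli_fps_chi[symmetric])
  finally have "- ?r F = F"
  proof (rule mult_right_cancel[THEN iffD1, rotated])
    have "fps_nth (?E (of_nat q) - 1) 1 \<noteq> 0"
      using q by simp
    then show "?E (of_nat q) - 1 \<noteq> 0"
      by (metis fps_zero_nth)
  qed
  then have "fps_nth (- ?r F) k = fps_nth F k"
    by simp
  then show ?thesis
    using assms by (simp add: gen_bernoulli_def fps_compose_uminus')
qed

text \<open>Translation by \<open>q\<close> in the functional is multiplication of \<open>F\<close>
  by \<open>exp (q t)\<close>. On monomials the claim compares coefficients of the generating
  function identity, whose factor \<open>t\<close> produces the derivatives.\<close>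

lemma moment_functional_shift:
  "moment_functional B (pcompose p [:of_nat q, 1:] - p) =
     poly (pderiv p) 1 - poly (pderiv p) (of_nat q - 1)"
proof (rule additive_poly_ext[of "\<lambda>p. moment_functional B (pcompose p [:of_nat q, 1:] - p)"])
  fix p r :: "complex poly"
  show "moment_functional B (pcompose (p + r) [:of_nat q, 1:] - (p + r)) =
      moment_functional B (pcompose p [:of_nat q, 1:] - p) +
      moment_functional B (pcompose r [:of_nat q, 1:] - r)"
    by (simp add: pcompose_add moment_functional_add moment_functional_diff)
  show "poly (pderiv (p + r)) 1 - poly (pderiv (p + r)) (of_nat q - 1) =
     poly (pderiv p) 1 - poly (pderiv p) (of_nat q - 1) +
     (poly (pderiv r) 1 - poly (pderiv r) (of_nat q - 1))"
    by (simp add: pderiv_add)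
next
  fix a :: complex and n :: nat
  let ?p = "monom a n" and ?q = "of_nat q :: complex"
  have pc: "pcompose ?p [:?q, 1:] = smult a ([:?q, 1:] ^ n)"
    by (rule pcompose_monom)
  have "moment_functional B (pcompose ?p [:?q, 1:]) =
     (\<Sum>i\<le>n. a * (of_nat (n choose i) * ?q ^ (n - i)) * B i)"
  proof -
    have "degree (smult a ([:?q, 1:] ^ n)) \<le> n"
      using degree_smult_le[of a "[:?q, 1:] ^ n"] by (simp add: degree_linear_power)
    then show ?thesis
      unfolding pc by (subst moment_functional_eq_sum)
        (auto intro!: sum.cong simp: coeff_linear_poly_power)
  qed
  also have "\<dots> = a * fact n * (\<Sum>i\<le>n. fps_nth F i * (?q ^ (n - i) / fact (n - i)))"
    unfolding sum_distrib_left
    by (intro sum.cong) (simp_all add: gen_bernoulli_def binomial_fact field_simps)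
  also have "\<dots> = a * fact n * fps_nth (F * fps_exp ?q) n"
    by (simp add: fps_mult_nth atLeast0AtMost)
  finally have "moment_functional B (pcompose ?p [:?q, 1:] - ?p) =
      a * fact n * fps_nth (F * fps_exp ?q - F) n"
    by (simp add: moment_functional_diff gen_bernoulli_def algebra_simps)
  also have "F * fps_exp ?q - F = fps_X * (fps_exp 1 - fps_exp (?q - 1))"
    using gen_bernoulli_fps_chi by (simp add: algebra_simps)
  also have "a * fact n * fps_nth (fps_X * (fps_exp 1 - fps_exp (?q - 1))) n =
      poly (pderiv ?p) 1 - poly (pderiv ?p) (?q - 1)"
    by (cases n) (simp_all add: pderiv_monom poly_monom field_simps)
  finally show "moment_functional B (pcompose ?p [:?q, 1:] - ?p) =
      poly (pderiv ?p) 1 - poly (pderiv ?p) (?q - 1)" .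
qed

lemma gen_bernoulli_chi_1: "B 1 = - (of_nat q - 2) / of_nat q"
proof -
  let ?q = "of_nat q :: complex"
  \<comment> \<open>The shift relation at \<open>y^2\<close> involves only \<open>B 0\<close>, which
    vanishes by parity, and \<open>B 1\<close>.\<close>
  have "pcompose (monom 1 2) [:?q, 1:] - monom 1 2 = monom (?q ^ 2) 0 + monom (2 * ?q) 1"
    by (simp add: monom_altdef pcompose_pCons power2_eq_square numeral_2_eq_2 algebra_simps)
  then have "?q ^ 2 * B 0 + 2 * ?q * B 1 = 2 - 2 * (?q - 1)"
    using moment_functional_shift[of "monom 1 2"]
    by (simp add: moment_functional_add pderiv_monom poly_monom)
  then have "2 * (?q * B 1) = 2 * (2 - ?q)"
    using gen_bernoulli_chi_even[of 0] by (simp add: algebra_simps)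
  then have "?q * B 1 = 2 - ?q"
    by (simp only: mult_cancel_left) simp
  then show ?thesis
    using q by (simp add: field_simps)
qed

section \<open>The two monic bases and their behaviour under a shift by \<open>q\<close>\<close>

private definition "\<Phi> k = (\<Prod>i<k. [:- ((of_nat q * of_nat (i + 1) - 1) ^ 2), 1 :: complex:])"
private definition "\<Psi> k = (\<Prod>i<k. [:- ((of_nat q * of_nat i + 1) ^ 2), 1 :: complex:])"

lemma degree_lead_\<Phi>: "degree (\<Phi> k) = k" "lead_coeff (\<Phi> k) = 1"
proof -
  show "degree (\<Phi> k) = k"
    unfolding \<Phi>_def by (subst degree_prod_eq_sum_degree) auto
  show "lead_coeff (\<Phi> k) = 1"
    unfolding \<Phi>_def by (subst lead_coeff_prod) simp
qed

lemma \<Phi>_Suc: "\<Phi> (Suc k) = \<Phi> k * [:- ((of_nat q * of_nat (k + 1) - 1) ^ 2), 1:]"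
  by (simp only: \<Phi>_def prod.lessThan_Suc)

lemma degree_lead_\<Psi>: "degree (\<Psi> k) = k" "lead_coeff (\<Psi> k) = 1"
proof -
  show "degree (\<Psi> k) = k"
    unfolding \<Psi>_def by (subst degree_prod_eq_sum_degree) auto
  show "lead_coeff (\<Psi> k) = 1"
    unfolding \<Psi>_def by (subst lead_coeff_prod) simp
qed

lemma \<Psi>_Suc: "\<Psi> (Suc k) = \<Psi> k * [:- ((of_nat q * of_nat k + 1) ^ 2), 1:]"
  by (simp only: \<Psi>_def prod.lessThan_Suc)

text \<open>In \<open>y\<close>, the roots form two progressions of step \<open>q\<close>, so a
  shift by \<open>q\<close> cancels all but the end factors; denominators are cleared to keep every
  \<open>y\<close> admissible. With \<open>A = q (k + 1) - 1\<close>, the linear factors are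
  \<open>A - x\<close> and \<open>x - 1\<close>, taken at \<open>x = y + q\<close> on the left and
  at \<open>x = - y\<close> on the right.\<close>

lemma poly_\<Phi>_shift:
  fixes y :: complex
  shows "poly (\<Phi> k) ((y + of_nat q) ^ 2) * (of_nat q * of_nat k - 1 - y) * (y + of_nat q - 1) =
    poly (\<Phi> k) (y ^ 2) * (of_nat q * of_nat (k + 1) - 1 + y) * (- y - 1)"
proof (induction k)
  case 0
  show ?case by (simp add: \<Phi>_def algebra_simps)
next
  case (Suc k)
  let ?A = "of_nat q * of_nat (k + 1) - 1 :: complex"
  have rec: "poly (\<Phi> (Suc k)) z = poly (\<Phi> k) z * (z - ?A ^ 2)" for z
    by (simp add: \<Phi>_Suc algebra_simps)
  have "poly (\<Phi> (Suc k)) ((y + of_nat q) ^ 2) * (of_nat q * of_nat (Suc k) - 1 - y) * (y + of_nat q - 1) =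
     (poly (\<Phi> k) ((y + of_nat q) ^ 2) * (of_nat q * of_nat k - 1 - y) * (y + of_nat q - 1)) *
     - ((y + of_nat q + ?A) * (?A - y))"
    unfolding rec by (simp add: power2_eq_square algebra_simps)
  also have "\<dots> = poly (\<Phi> (Suc k)) (y ^ 2) * (of_nat q * of_nat (Suc k + 1) - 1 + y) * (- y - 1)"
    unfolding rec Suc.IH by (simp add: power2_eq_square algebra_simps)
  finally show ?case .
qed

text \<open>The same cancellation with linear factors \<open>C - x\<close> and
  \<open>x + 1 - q\<close>, where \<open>C = q j + 1\<close> and \<open>j\<close> is the index
  written \<open>k\<close> here.\<close>

lemma poly_\<Psi>_shift:
  fixes y :: complex
  shows "poly (\<Psi> k) ((y + of_nat q) ^ 2) * (of_nat q * of_nat k + 1 - y - of_nat q) * (y + 1) =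
    poly (\<Psi> k) (y ^ 2) * (of_nat q * of_nat k + 1 + y) * (1 - of_nat q - y)"
proof (induction k)
  case 0
  show ?case by (simp add: \<Psi>_def algebra_simps)
next
  case (Suc k)
  let ?C = "of_nat q * of_nat k + 1 :: complex"
  have rec: "poly (\<Psi> (Suc k)) z = poly (\<Psi> k) z * (z - ?C ^ 2)" for z
    by (simp add: \<Psi>_Suc algebra_simps)
  have "poly (\<Psi> (Suc k)) ((y + of_nat q) ^ 2) * (of_nat q * of_nat (Suc k) + 1 - y - of_nat q) * (y + 1) =
     (poly (\<Psi> k) ((y + of_nat q) ^ 2) * (of_nat q * of_nat k + 1 - y - of_nat q) * (y + 1)) *
     - ((y + of_nat q + ?C) * (?C - y))"
    unfolding rec by (simp add: power2_eq_square algebra_simps)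
  also have "\<dots> = poly (\<Psi> (Suc k)) (y ^ 2) * (of_nat q * of_nat (Suc k) + 1 + y) * (1 - of_nat q - y)"
    unfolding rec Suc.IH by (simp add: power2_eq_square algebra_simps)
  finally show ?case .
qed

text \<open>For \<open>k > 0\<close> the factor at \<open>i = 0\<close> vanishes; for
  \<open>k = 0\<close> the linear factor takes over. The product treats both cases at once when
  double roots are needed.\<close>

lemma \<Phi>_root: "poly (\<Phi> k) ((of_nat q - 1) ^ 2) * (of_nat q * of_nat (k + 1) - 1 - (of_nat q - 1)) = 0"
  by (cases k) (simp_all add: \<Phi>_def poly_prod prod.lessThan_Suc_shift del: prod.lessThan_Suc)

lemma \<Psi>_root: "poly (\<Psi> k) 1 * (of_nat q * of_nat k + 1 - 1) = 0"
  by (cases k) (simp_all add: \<Psi>_def poly_prod prod.lessThan_Suc_shift del: prod.lessThan_Suc)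

section \<open>Closed form of the mixed moments\<close>

private abbreviation (input) "D \<equiv> (\<lambda>k. B (2 * k + 1))"

text \<open>Apply the shift relation to
  \<open>p(y) = \<Phi>\<^sub>k(y\<^sup>2) \<Psi>\<^sub>j(y\<^sup>2) (A - y) (C - y) (y - 1) (y + 1 - q)\<close>: the products telescope to give
  \<open>p(y + q) = p(- y)\<close>, while \<open>1\<close> and \<open>q - 1\<close> are double roots of \<open>p\<close>.\<close>

lemma moment_functional_\<Phi>\<Psi>_linear:
  fixes k j :: nat
  defines "A \<equiv> of_nat q * of_nat (k + 1) - 1" and "C \<equiv> of_nat q * of_nat j + 1"
  shows "moment_functional D (\<Phi> k * \<Psi> j *
    [:of_nat (k + j + 1) * (of_nat q - 1) + A * C, of_nat (k + j + 2):]) = 0"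
proof -
  let ?q = "of_nat q :: complex"
  let ?sq = "[:0, 0, 1 :: complex:]"
  let ?R = "\<Phi> k * \<Psi> j * [:of_nat (k + j + 1) * (?q - 1) + A * C, of_nat (k + j + 2):]"
  define e where "e = of_nat (k + j + 1) * (?q - 1) + A * C"
  define K where "K = (of_nat (k + j + 2) :: complex)"
  define h where "h = pcompose (\<Phi> k * \<Psi> j) ?sq * [:A, -1:] * [:C, -1:]"
  define p where "p = [:-1, 1:] * [:1 - ?q, 1:] * h"
  have h: "poly h x = poly (\<Phi> k) (x ^ 2) * poly (\<Psi> j) (x ^ 2) * (A - x) * (C - x)" for x
    by (simp add: h_def poly_pcompose power2_eq_square algebra_simps)
  have p: "poly p x = (x - 1) * (x + 1 - ?q) * poly h x" for x
    by (simp add: p_def algebra_simps)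
  have h_root: "poly h 1 = 0" "poly h (?q - 1) = 0"
    using \<Phi>_root[of k] \<Psi>_root[of j] by (auto simp: h A_def C_def)
  \<comment> \<open>Both the quadratic factor and \<open>h\<close> vanish at 1 and
    \<open>q - 1\<close>, so each term of the product rule for \<open>p\<close> does too.\<close>
  have "poly ([:-1, 1:] * [:1 - ?q, 1:]) 1 = 0" "poly ([:-1, 1:] * [:1 - ?q, 1:]) (?q - 1) = 0"
    by simp_all
  then have deriv: "poly (pderiv p) 1 = 0" "poly (pderiv p) (?q - 1) = 0"
    unfolding p_def pderiv_mult[of _ h] poly_add poly_mult[of _ h] poly_mult[of _ "pderiv h"]
    by (simp_all only: h_root poly_mult mult_zero_left mult_zero_right add_0_left)
  have AC: "A + C = ?q * of_nat (k + j + 1)"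
    by (simp add: A_def C_def algebra_simps)
  have "poly (pcompose p [:?q, 1:]) y = poly (pcompose p [:0, -1:]) y" for y
  proof -
    have "poly p (y + ?q) =
      (poly (\<Phi> k) ((y + ?q) ^ 2) * (?q * of_nat k - 1 - y) * (y + ?q - 1)) *
      (poly (\<Psi> j) ((y + ?q) ^ 2) * (?q * of_nat j + 1 - y - ?q) * (y + 1))"
      unfolding p h A_def C_def by (simp add: algebra_simps)
    also have "\<dots> = poly p (- y)"
      unfolding poly_\<Phi>_shift poly_\<Psi>_shift p h A_def C_def
      by (simp add: algebra_simps)
    finally show ?thesis
      by (simp add: poly_pcompose add.commute)
  qed
  then have shift: "pcompose p [:?q, 1:] - p = pcompose p [:0, -1:] - p"
    by (simp add: poly_eq_poly_eq_iff[symmetric] fun_eq_iff)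
  \<comment> \<open>The difference \<open>p(- y) - p(y)\<close> is odd in \<open>y\<close>. Since
    \<open>A + C\<close> is a multiple of \<open>q\<close>, the factor \<open>2 q y\<close> comes
    out and leaves a linear polynomial in \<open>y^2\<close> beside the two basis elements.\<close>
  moreover have "pcompose p [:0, -1:] - p = smult (2 * ?q) ([:0, 1:] * pcompose ?R ?sq)"
  proof (rule poly_ext)
    fix y
    have "poly (pcompose p [:0, -1:] - p) y = poly (\<Phi> k) (y ^ 2) * poly (\<Psi> j) (y ^ 2) *
       ((A + y) * (C + y) * (- y - 1) * (1 - ?q - y) - (A - y) * (C - y) * (y - 1) * (y + 1 - ?q))"
      by (simp add: poly_pcompose p h algebra_simps)
    also have "(A + y) * (C + y) * (- y - 1) * (1 - ?q - y) - (A - y) * (C - y) * (y - 1) * (y + 1 - ?q) =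
       2 * y * ((?q + (A + C)) * y ^ 2 + (A + C) * (?q - 1) + ?q * (A * C))"
      by (simp add: power2_eq_square algebra_simps)
    also have "\<dots> = 2 * ?q * (y * (of_nat (k + j + 1) * (?q - 1) + A * C + of_nat (k + j + 2) * y ^ 2))"
      unfolding AC by (simp add: algebra_simps)
    finally show "poly (pcompose p [:0, -1:] - p) y = poly (smult (2 * ?q) ([:0, 1:] * pcompose ?R ?sq)) y"
      unfolding e_def[symmetric] K_def[symmetric]
      by (simp add: poly_pcompose power2_eq_square algebra_simps)
  qed
  ultimately have "moment_functional B (smult (2 * ?q) ([:0, 1:] * pcompose ?R ?sq)) = 0"
    using moment_functional_shift[of p] shift by (simp only: deriv diff_self)
  then have "2 * ?q * moment_functional D ?R = 0"
    by (simp only: moment_functional_smult moment_functional_odd_part)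
  then show ?thesis
    using q by simp
qed

text \<open>One induction step of the closed form: \<open>c1\<close>, \<open>c2\<close> are
  consecutive Hilbert denominators and \<open>w\<close> is, up to sign, the new factor of
  \<open>u\<close> or \<open>v\<close>. The two conclusions serve the two directions of
  induction.\<close>

private lemma ratio_step:
  fixes c1 c2 :: complex
  assumes "c2 * X = - (c1 * w) * (b * x * y / c1)" "c1 \<noteq> 0" "c2 \<noteq> 0"
  shows "X = b * (x * - w) * y / c2" "X = b * y * (x * - w) / c2"
  using assms by (simp_all add: field_simps)

private definition u :: "nat \<Rightarrow> complex" where
  "u k = (\<Prod>i<k.
     - (of_nat q * of_nat (i + 1) * (of_nat q * of_nat (i + 1) + (of_nat q - 2))))"
private definition v :: "nat \<Rightarrow> complex" where
  "v k = (\<Prod>i<k.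
     - (of_nat q * of_nat (i + 1) * (of_nat q * of_nat (i + 1) - (of_nat q - 2))))"

text \<open>Reducing the next linear factor modulo the annihilated one leaves a multiple of the
  previous moment. Apart from \<open>k + j + 1\<close>, the multiplier depends on \<open>k\<close>
  alone or on \<open>j\<close> alone; this separates the variables.\<close>

lemma moment_functional_\<Phi>\<Psi>_Suc:
  fixes k j :: nat
  shows "of_nat (k + j + 2) * moment_functional D (\<Phi> (Suc k) * \<Psi> j) =
      - (of_nat (k + j + 1) * (of_nat q * of_nat (k + 1) * (of_nat q * of_nat (k + 1) + (of_nat q - 2)))) *
        moment_functional D (\<Phi> k * \<Psi> j)" (is ?thesis1)
    and "of_nat (k + j + 2) * moment_functional D (\<Phi> k * \<Psi> (Suc j)) =
      - (of_nat (k + j + 1) * (of_nat q * of_nat (j + 1) * (of_nat q * of_nat (j + 1) - (of_nat q - 2)))) *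
        moment_functional D (\<Phi> k * \<Psi> j)" (is ?thesis2)
proof -
  let ?q = "of_nat q :: complex"
  define A where "A = ?q * of_nat (k + 1) - 1"
  define C where "C = ?q * of_nat j + 1"
  define e where "e = of_nat (k + j + 1) * (?q - 1) + A * C"
  have step: "of_nat (k + j + 2) * moment_functional D (\<Phi> k * \<Psi> j * [:- (x ^ 2), 1:]) =
      - (e + of_nat (k + j + 2) * x ^ 2) * moment_functional D (\<Phi> k * \<Psi> j)" for x
  proof -
    have "smult (of_nat (k + j + 2)) (\<Phi> k * \<Psi> j * [:- (x ^ 2), 1:]) =
       \<Phi> k * \<Psi> j * [:e, of_nat (k + j + 2):] + smult (- (e + of_nat (k + j + 2) * x ^ 2)) (\<Phi> k * \<Psi> j)"
      by (rule poly_ext) (simp add: algebra_simps)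
    then have "of_nat (k + j + 2) * moment_functional D (\<Phi> k * \<Psi> j * [:- (x ^ 2), 1:]) =
       moment_functional D (\<Phi> k * \<Psi> j * [:e, of_nat (k + j + 2):]) +
       - (e + of_nat (k + j + 2) * x ^ 2) * moment_functional D (\<Phi> k * \<Psi> j)"
      by (metis moment_functional_add moment_functional_smult)
    then show ?thesis
      using moment_functional_\<Phi>\<Psi>_linear[of k j] by (simp only: e_def A_def C_def) simp
  qed
  have "\<Phi> (Suc k) * \<Psi> j = \<Phi> k * \<Psi> j * [:- (A ^ 2), 1:]"
    by (simp only: \<Phi>_def A_def prod.lessThan_Suc mult_ac)
  moreover have "e + of_nat (k + j + 2) * A ^ 2 =
      of_nat (k + j + 1) * (?q * of_nat (k + 1) * (?q * of_nat (k + 1) + (?q - 2)))"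
    unfolding e_def A_def C_def by (simp add: algebra_simps power2_eq_square)
  ultimately show ?thesis1
    using step[of A] by (simp only:)
  have "\<Phi> k * \<Psi> (Suc j) = \<Phi> k * \<Psi> j * [:- (C ^ 2), 1:]"
    by (simp only: \<Psi>_def C_def prod.lessThan_Suc mult_ac)
  moreover have "e + of_nat (k + j + 2) * C ^ 2 =
      of_nat (k + j + 1) * (?q * of_nat (j + 1) * (?q * of_nat (j + 1) - (?q - 2)))"
    unfolding e_def A_def C_def by (simp add: algebra_simps power2_eq_square)
  ultimately show ?thesis2
    using step[of C] by (simp only:)
qed

text \<open>Starting from \<open>B 1\<close> at \<open>k = j = 0\<close>, the ratios
  \<open>(k + j + 1) / (k + j + 2)\<close> telescope to the Hilbert entry while \<open>u\<close> and
  \<open>v\<close> collect the separated factors.\<close>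

lemma moment_functional_\<Phi>\<Psi>:
  "moment_functional D (\<Phi> k * \<Psi> j) = B 1 * u k * v j / of_nat (k + j + 1)"
proof (induction j)
  case 0
  show ?case
  proof (induction k)
    case 0
    show ?case
      by (simp add: \<Phi>_def \<Psi>_def u_def v_def moment_functional_def)
  next
    case (Suc k)
    have "u (Suc k) = u k * - (of_nat q * of_nat (k + 1) * (of_nat q * of_nat (k + 1) + (of_nat q - 2)))"
      by (simp add: u_def)
    moreover have "Suc k + 0 + 1 = k + 0 + 2"
      by simp
    ultimately show ?case
      using moment_functional_\<Phi>\<Psi>_Suc(1)[of k 0, unfolded Suc.IH]
      by (simp only:) (erule ratio_step; simp only: of_nat_eq_0_iff; simp)
  qed
next
  case (Suc j)
  have "v (Suc j) = v j * - (of_nat q * of_nat (j + 1) * (of_nat q * of_nat (j + 1) - (of_nat q - 2)))"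
    by (simp add: v_def)
  moreover have "k + Suc j + 1 = k + j + 2"
    by simp
  moreover have "B 1 * u k * v j = B 1 * v j * u k"
    by simp
  ultimately show ?case
    using moment_functional_\<Phi>\<Psi>_Suc(2)[of k j, unfolded Suc.IH]
    by (simp only:) (erule ratio_step; simp only: of_nat_eq_0_iff; simp)
qed

text \<open>The \<open>i\<close>-th pivot: the product of the \<open>i\<close>-th diagonal entries
  of the lower and upper triangular factors of the moment matrix.\<close>

private definition "\<delta> i = B 1 * u i * v i * of_nat (2 * i + 1) * (fact i ^ 2 / fact (2 * i + 1)) ^ 2"

text \<open>Scaling rows by \<open>u\<close> and columns by \<open>v\<close> keeps the factors of
  the Hilbert matrix triangular, so only diagonal entries enter.\<close>

lemma hankel_det_odd_gen_bernoulli_chi: "hankel_det m D = (\<Prod>i<m + 1. \<delta> i)"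
proof -
  let ?N = "m + 1"
  let ?a = "hilbert_factor :: nat \<Rightarrow> nat \<Rightarrow> complex"
  have diag: "?a i i = fact i ^ 2 / fact (2 * i + 1)" for i
    by (simp add: hilbert_factor_def flip: mult_2)
  have entry: "moment_functional D (\<Phi> i * \<Psi> j) =
      (\<Sum>n<?N. (B 1 * u i * of_nat (2 * n + 1) * ?a i n) * (v j * ?a j n))" if "i < ?N" for i j
  proof -
    have "moment_functional D (\<Phi> i * \<Psi> j) = B 1 * u i * v j * (1 / of_nat (i + j + 1))"
      by (simp only: moment_functional_\<Phi>\<Psi>) simp
    also have "\<dots> = (\<Sum>n<?N. (B 1 * u i * of_nat (2 * n + 1) * ?a i n) * (v j * ?a j n))"
      unfolding hilbert_matrix_factorization[OF that] sum_distrib_left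
      by (intro sum.cong) (simp_all only: mult_ac)
    finally show ?thesis .
  qed
  have "hankel_det m D = det (mat ?N ?N (\<lambda>(i, j). moment_functional D (\<Phi> i * \<Psi> j)))"
    by (rule hankel_det_monic_bases
        [OF degree_lead_\<Phi>(1) degree_lead_\<Psi>(1) degree_lead_\<Phi>(2) degree_lead_\<Psi>(2)])
  also have "mat ?N ?N (\<lambda>(i, j). moment_functional D (\<Phi> i * \<Psi> j)) =
      mat ?N ?N (\<lambda>(i, j).
        \<Sum>n<?N. (B 1 * u i * of_nat (2 * n + 1) * ?a i n) * (v j * ?a j n))"
    by (intro cong_mat refl) (simp only: prod.case entry)
  also have "det \<dots> = det (mat ?N ?N (\<lambda>(i, n). B 1 * u i * of_nat (2 * n + 1) * ?a i n)) *
      det (mat ?N ?N (\<lambda>(n, j). v j * ?a j n))"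
    by (rule det_mat_sum)
  also have "det (mat ?N ?N (\<lambda>(i, n). B 1 * u i * of_nat (2 * n + 1) * ?a i n)) =
      (\<Prod>i<?N. B 1 * u i * of_nat (2 * i + 1) * ?a i i)"
    by (rule det_mat_lower_triangular) (simp add: hilbert_factor_def)
  also have "det (mat ?N ?N (\<lambda>(n, j). v j * ?a j n)) = det (mat ?N ?N (\<lambda>(j, n). v j * ?a j n))"
    by (rule det_mat_transpose)
  also have "\<dots> = (\<Prod>i<?N. v i * ?a i i)"
    by (rule det_mat_lower_triangular) (simp add: hilbert_factor_def)
  also have "(\<Prod>i<?N. B 1 * u i * of_nat (2 * i + 1) * ?a i i) * (\<Prod>i<?N. v i * ?a i i) =
      (\<Prod>i<?N. \<delta> i)"
    unfolding prod.distrib[symmetric] diag \<delta>_def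
    by (intro prod.cong refl) (simp only: power2_eq_square mult_ac)
  finally show ?thesis .
qed

section \<open>Squared pivots and the final product\<close>

private definition "\<beta> l =
          of_nat l ^ 4 * ((of_nat q - 2) ^ 2 - (of_nat q * of_nat l) ^ 2) /
          (4 * (2 * of_nat l + 1) * (2 * of_nat l - 1) :: complex)"

text \<open>The new factors of \<open>u\<close> and \<open>v\<close> multiply to a difference of
  squares opposite in sign to the one in \<open>\<beta>\<close>; the resulting minus disappears on
  squaring.\<close>

lemma \<delta>_Suc: "\<delta> (Suc i) = \<delta> i * - (of_nat q ^ 2 * \<beta> (Suc i))"
proof -
  let ?q = "of_nat q :: complex" and ?l = "of_nat i + 1 :: complex"
  have nz: "2 * (of_nat i :: complex) + 1 \<noteq> 0" "2 * (of_nat i :: complex) + 3 \<noteq> 0"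
    "(of_nat i :: complex) + 1 \<noteq> 0" "2 * (of_nat i :: complex) + 2 \<noteq> 0"
    using of_nat_neq_0[of "2 * i", where ?'a = complex] of_nat_neq_0[of "2 * i + 2", where ?'a = complex]
       of_nat_neq_0[of i, where ?'a = complex] of_nat_neq_0[of "2 * i + 1", where ?'a = complex]
    by (simp_all add: algebra_simps)
  have F: "fact (2 * Suc i + 1) = (2 * of_nat i + 3) * (2 * ?l) * (fact (2 * i + 1) :: complex)"
    by (simp add: algebra_simps)
  have b: "\<beta> (Suc i) = ?l ^ 4 * ((?q - 2) ^ 2 - (?q * ?l) ^ 2) / (4 * (2 * of_nat i + 3) * (2 * of_nat i + 1))"
    by (simp add: \<beta>_def algebra_simps)
  have uv: "u (Suc i) * v (Suc i) = u i * v i * (?q ^ 2 * ?l ^ 2 * ((?q * ?l) ^ 2 - (?q - 2) ^ 2))"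
    by (simp add: u_def v_def algebra_simps power2_eq_square)
  have "\<delta> (Suc i) = B 1 * (u (Suc i) * v (Suc i)) * (2 * of_nat i + 3) *
     ((?l * fact i) ^ 2 / ((2 * of_nat i + 3) * (2 * ?l) * fact (2 * i + 1))) ^ 2"
    unfolding \<delta>_def F by (simp add: add_ac)
  also have "\<dots> = B 1 * u i * v i * (2 * of_nat i + 1) * (fact i ^ 2 / fact (2 * i + 1)) ^ 2 *
     - (?q ^ 2 * \<beta> (Suc i))"
  proof -
    have "L * (W * (q2 * l ^ 2 * (s - t))) * d * ((l * f) ^ 2 / (d * (2 * l) * g)) ^ 2 =
        L * W * e * (f ^ 2 / g) ^ 2 * - (q2 * (l ^ 4 * (t - s) / (4 * d * e)))"
      if "d \<noteq> 0" "e \<noteq> 0" "l \<noteq> 0" "g \<noteq> 0" for L W q2 l s t d f g e :: complex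
      using that by (simp add: field_simps power2_eq_square power4_eq_xxxx)
    from this[of "2 * of_nat i + 3" "2 * of_nat i + 1" ?l "fact (2 * i + 1)" "B 1" "u i * v i" "?q ^ 2"
       "(?q * ?l) ^ 2" "(?q - 2) ^ 2" "fact i"] nz
    show ?thesis
      unfolding uv b by (simp only: mult.assoc fact_nonzero not_False_eq_True simp_thms)
  qed
  finally show ?thesis
    by (simp add: \<delta>_def)
qed

lemma \<delta>_square: "\<delta> i ^ 2 = (of_nat q - 2) ^ 2 / of_nat q ^ 2 * (of_nat q ^ (4 * i) * (\<Prod>l = 1..i. \<beta> l ^ 2))"
proof (induction i)
  case 0
  show ?case
    by (simp add: \<delta>_def u_def v_def gen_bernoulli_chi_1[unfolded One_nat_def] power_divide power2_commute)
next
  case (Suc i)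
  have "\<delta> (Suc i) ^ 2 = \<delta> i ^ 2 * (of_nat q ^ 4 * \<beta> (Suc i) ^ 2)"
    unfolding \<delta>_Suc by (simp add: power_mult_distrib flip: power_mult)
  then show ?case
    unfolding Suc.IH by (simp add: power_add mult_ac)
qed

text \<open>Passing from \<open>m\<close> to \<open>m + 1\<close> multiplies by a squared pivot,
  which contains each \<open>\<beta> l ^ 2\<close> with \<open>l \<le> m + 1\<close> once; hence the
  exponents \<open>2 * (m + 1 - l)\<close>.\<close>

lemma hankel_det_odd_gen_bernoulli_chi_square:
  "hankel_det m D ^ 2 = (of_nat q powi (int m - 1) * (of_nat q - 2)) ^ (2 * m + 2) *
     (\<Prod>l = 1..m. \<beta> l ^ (2 * (m + 1 - l)))"
proof (induction m)
  case 0
  show ?case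
    unfolding hankel_det_odd_gen_bernoulli_chi
    by (simp add: \<delta>_square[of 0] power_int_minus divide_inverse)
       (simp add: power2_eq_square mult_ac)
next
  case (Suc m)
  let ?q = "of_nat q :: complex"
  have q0: "?q \<noteq> 0"
    using q by simp
  \<comment> \<open>Natural powers divided by \<open>q\<close> also cover the exponent -1 at
    \<open>n = 0\<close>.\<close>
  have pow: "?q powi (int n - 1) = ?q ^ n / ?q" for n
    using q0 by (simp add: power_int_diff)
  have "(\<Prod>l = 1..m. \<beta> l ^ (2 * (Suc m + 1 - l))) =
      (\<Prod>l = 1..m. \<beta> l ^ (2 * (m + 1 - l))) * (\<Prod>l = 1..m. \<beta> l ^ 2)"
    unfolding prod.distrib[symmetric]
  proof (intro prod.cong refl)
    fix l assume "l \<in> {1..m}"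
    then have "2 * (Suc m + 1 - l) = 2 * (m + 1 - l) + 2"
      by auto
    then show "\<beta> l ^ (2 * (Suc m + 1 - l)) = \<beta> l ^ (2 * (m + 1 - l)) * \<beta> l ^ 2"
      by (simp only: power_add)
  qed
  \<comment> \<open>For \<open>l = Suc m\<close> the exponent is 2, so this factor lies entirely in
    the second product.\<close>
  then have beta: "(\<Prod>l = 1..Suc m. \<beta> l ^ (2 * (Suc m + 1 - l))) =
      (\<Prod>l = 1..m. \<beta> l ^ (2 * (m + 1 - l))) * (\<Prod>l = 1..Suc m. \<beta> l ^ 2)"
    by simp
  \<comment> \<open>The exponent of \<open>q\<close> grows by
    \<open>(2 m + 4) + 2 (m - 1) = 4 (m + 1) - 2\<close>, matching the squared pivot.\<close>
  have scale: "(?q ^ Suc m / ?q * (?q - 2)) ^ (2 * Suc m + 2) =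
      (?q ^ m / ?q * (?q - 2)) ^ (2 * m + 2) * ((?q - 2) ^ 2 / ?q ^ 2 * ?q ^ (4 * Suc m))"
  proof -
    have split: "(x * a) ^ (n + 2) = a ^ n * (x ^ (n + 2) * a ^ 2)" for x a :: complex and n
      by (simp only: power_mult_distrib power_add) (simp only: mult_ac)
    have "?q ^ Suc m / ?q * (?q - 2) = ?q * (?q ^ m / ?q * (?q - 2))" "2 * Suc m + 2 = 2 * m + 2 + 2"
      by simp_all
    then have "(?q ^ Suc m / ?q * (?q - 2)) ^ (2 * Suc m + 2) =
        (?q ^ m / ?q * (?q - 2)) ^ (2 * m + 2) * (?q ^ (2 * m + 2 + 2) * (?q ^ m / ?q * (?q - 2)) ^ 2)"
      by (simp only: split)
    also have "?q ^ (2 * m + 2 + 2) * (?q ^ m / ?q * (?q - 2)) ^ 2 = (?q - 2) ^ 2 / ?q ^ 2 * ?q ^ (4 * Suc m)"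
    proof -
      have exponents: "4 * Suc m = 2 * m + 2 + 2 + m * 2"
        by simp
      show ?thesis
        by (simp only: exponents power_add[of _ "2 * m + 2 + 2"] power_mult[of _ m]
            power_mult_distrib power_divide)
           (simp only: mult_ac times_divide_eq_left times_divide_eq_right)
    qed
    finally show ?thesis .
  qed
  have "hankel_det (Suc m) D ^ 2 = hankel_det m D ^ 2 * \<delta> (Suc m) ^ 2"
    by (simp only: hankel_det_odd_gen_bernoulli_chi) (simp add: power_mult_distrib)
  also have "\<dots> = (?q ^ m / ?q * (?q - 2)) ^ (2 * m + 2) * (\<Prod>l = 1..m. \<beta> l ^ (2 * (m + 1 - l))) *
      ((?q - 2) ^ 2 / ?q ^ 2 * (?q ^ (4 * Suc m) * (\<Prod>l = 1..Suc m. \<beta> l ^ 2)))"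
    by (simp only: Suc.IH \<delta>_square pow)
  also have "\<dots> = (?q ^ Suc m / ?q * (?q - 2)) ^ (2 * Suc m + 2) * (\<Prod>l = 1..Suc m. \<beta> l ^ (2 * (Suc m + 1 - l)))"
    unfolding beta scale by (simp only: mult_ac)
  finally show ?case
    by (simp only: pow)
qed

lemma hankel_det_gen_bernoulli_chi:
  "hankel_det (2 * m) B = 0"
  "hankel_det (2 * m + 1) B =
      (-1) ^ (m + 1) * (of_nat q powi (int m - 1) * (of_nat q - 2)) ^ (2 * m + 2) *
      (\<Prod>l = 1..m.
        (of_nat l ^ 4 * ((of_nat q - 2)^2 - (of_nat q * of_nat l)^2) /
          (4 * (2 * of_nat l + 1) * (2 * of_nat l - 1))) ^ (2 * (m + 1 - l)))"
proof -
  show "hankel_det (2 * m) B = 0"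
    by (rule hankel_det_even_eq_0[OF gen_bernoulli_chi_even])
  have "hankel_det (2 * m + 1) B = (-1) ^ (m + 1) * hankel_det m D ^ 2"
    by (rule hankel_det_odd_eq[OF gen_bernoulli_chi_even])
  then show "hankel_det (2 * m + 1) B =
      (-1) ^ (m + 1) * (of_nat q powi (int m - 1) * (of_nat q - 2)) ^ (2 * m + 2) *
      (\<Prod>l = 1..m.
        (of_nat l ^ 4 * ((of_nat q - 2)^2 - (of_nat q * of_nat l)^2) /
          (4 * (2 * of_nat l + 1) * (2 * of_nat l - 1))) ^ (2 * (m + 1 - l)))"
    by (simp only: hankel_det_odd_gen_bernoulli_chi_square \<beta>_def mult.assoc)
qed

end

theorem corollary3p5:
  fixes q m :: nat
  assumes "q \<in> {3, 4, 6}"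
  shows "hankel_det (2 * m) (gen_bernoulli q (chi q)) = 0 \<and>
    hankel_det (2 * m + 1) (gen_bernoulli q (chi q)) =
      (-1) ^ (m + 1) * (of_nat q powi (int m - 1) * (of_nat q - 2)) ^ (2 * m + 2) *
      (\<Prod>l = 1..m.
        (of_nat l ^ 4 * ((of_nat q - 2)^2 - (of_nat q * of_nat l)^2) /
          (4 * (2 * of_nat l + 1) * (2 * of_nat l - 1))) ^ (2 * (m + 1 - l)))"
proof -
  have "3 \<le> q"
    using assms by auto
  from hankel_det_gen_bernoulli_chi[OF this, of m] show ?thesis
    by (rule conjI)
qed

end
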